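(* Let $2\leq r<s$ and $3\leq g$ be integers. Then there exists an $(r,s;g)$-babi-graph, and the minimum order $n_{bb}(r,s;g)$ of such a graph satisfies $$n_{bb}(r,s;g)\leq 32\left( \sum_{t=1}^{g-2}(r-1)^t\right) \left( \sum_{t=1}^{g-2}(s-1)^t\right).$$
   Context: Graphs are finite and simple. The girth of a graph is the length of its shortest cycle; the order of a graph is its number of vertices. For integers $1\leq r\leq s$ and $g\geq 3$, an $(r,s;g)$-balanced biregular graph (for short, $(r,s;g)$-babi-graph) is a graph of girth $g$ whose set of vertex degrees equals $\{r,s\}$ and in which the number of vertices of degree $r$ equals the number of vertices of degree $s$. $n_{bb}(r,s;g)$ denotes the minimum order of an $(r,s;g)$-babi-graph. *)

theory Defs
  imports "Graph_Theory.Pair_Digraph" "HOL-Library.Extended_Nat"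
begin

text \<open>
  A finite simple graph is a \<^locale>\<open>pair_graph\<close>: a finite, loop-free, symmetric digraph whose arcs
  are pairs of vertices. Every undirected edge is thus represented by its two orientations, and the
  degree of a vertex \<open>v\<close> is \<open>out_degree G v\<close>, the number of its neighbours.

  For \<open>pre_digraph.cycle\<close>, traversing an edge back and forth counts as a cycle of length 2. Since
  there are no loops and no parallel arcs, the requirement \<open>3 \<le> length p\<close> removes exactly these.
\<close>

definition ugraph_cycle :: "'a pair_pre_digraph \<Rightarrow> ('a \<times> 'a) awalk \<Rightarrow> bool" where
  "ugraph_cycle G p \<longleftrightarrow> pre_digraph.cycle (with_proj G) p \<and> 3 \<le> length p"

text \<open>The girth of a graph without cycles is \<open>\<infinity>\<close>.\<close>

definition girth :: "'a pair_pre_digraph \<Rightarrow> enat" where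
  "girth G = (INF p \<in> {p. ugraph_cycle G p}. enat (length p))"

definition babi_graph :: "nat \<Rightarrow> nat \<Rightarrow> nat \<Rightarrow> 'a pair_pre_digraph \<Rightarrow> bool" where
  "babi_graph r s g G \<longleftrightarrow>
     pair_graph G \<and>
     girth G = enat g \<and>
     out_degree G ` pverts G = {r, s} \<and>
     card {v \<in> pverts G. out_degree G v = r} = card {v \<in> pverts G. out_degree G v = s}"

text \<open>
  Every finite graph is isomorphic to one whose vertices are natural numbers, so the minimum may be
  taken over these. If there is no such graph, \<open>LEAST\<close> yields an unspecified value; existence has
  to be asserted separately.
\<close>

definition n_bb :: "nat \<Rightarrow> nat \<Rightarrow> nat \<Rightarrow> nat" where
  "n_bb r s g = (LEAST n. \<exists>G :: nat pair_pre_digraph. babi_graph r s g G \<and> card (pverts G) = n)"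

end

theory Submission
  imports Defs
begin

text \<open>
  The construction is the edge-switching argument of Erdos and Sachs, run once on a vertex set in
  which half of the vertices aim at degree \<open>r\<close> and the other half at degree \<open>s\<close>.
  
  Write \<open>B = (\<Sum>t = 1..g - 2. (s - 1) ^ t)\<close> and let \<open>V\<close> have \<open>32 * B\<close> vertices. Among the graphs on \<open>V\<close>
  that contain one fixed \<open>g\<close>-cycle, have no shorter cycle and exceed no target degree, take one with
  the largest number of edges; the claim is that it attains all targets. Call a vertex deficient if its
  degree is below its target. A deficient vertex \<open>u\<close> has degree less than \<open>s\<close>, so at most \<open>1 + B\<close> vertices
  are within distance \<open>g - 2\<close> of \<open>u\<close> (\<open>card_walk_ball_le\<close>). No vertex \<open>w\<close> outside this ball is deficient, as
  otherwise the edge \<open>uw\<close> could be added. If some \<open>u\<close> is deficient, then by parity of the degree sum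
  there is a deficient \<open>v \<noteq> u\<close>, or \<open>u\<close> lacks two edges and \<open>v = u\<close> will do. Let \<open>X\<close> consist of the two
  balls and the fixed cycle. More than \<open>card X\<close> vertices outside \<open>X\<close> have the target, hence the degree,
  \<open>s\<close>; since no degree exceeds \<open>s\<close>, the set \<open>X\<close> cannot absorb all their edges, and there is an
  edge \<open>xy\<close> outside \<open>X\<close>. Replacing \<open>xy\<close> by \<open>ux\<close> and \<open>vy\<close> changes the degrees of \<open>u\<close> and \<open>v\<close> only, creates no
  short cycle (\<open>cycles_longer_switch\<close>) and increases the number of edges, a contradiction
  (\<open>saturated_extension_exists\<close>).
  
  The resulting graph has order \<open>32 * B\<close>, and the remaining factor \<open>(\<Sum>t = 1..g - 2. (r - 1) ^ t)\<close> of the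
  bound is at least \<open>1\<close>.
  
  The argument is carried out on symmetric relations. Distances and short cycles are expressed through
  relation powers, that is, through walks instead of paths, which can be concatenated without
  caring about repeated vertices.
\<close>

section \<open>Walks and short cycles\<close>

definition walk_ball :: "'a rel \<Rightarrow> nat \<Rightarrow> 'a \<Rightarrow> 'a set" where
  "walk_ball E k u = {v. \<exists>m\<le>k. (u, v) \<in> E ^^ m}"

text \<open>
  For a symmetric relation this says that every cycle is longer than \<open>k + 1\<close>: a walk of length \<open>m\<close> that joins
  the ends of an edge without using this edge contains a path that the edge closes to a
  cycle of length at most \<open>m + 1\<close>, and every cycle arises in this way from each of its edges.
\<close>

definition cycles_longer :: "nat \<Rightarrow> 'a rel \<Rightarrow> bool" where
  "cycles_longer k E \<longleftrightarrow> (\<forall>a b. (a, b) \<in> E \<longrightarrow> b \<notin> walk_ball (E - {(a, b), (b, a)}) k a)"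

lemma relpow_subset: "A \<subseteq> B \<Longrightarrow> A ^^ m \<subseteq> B ^^ m" for A :: "'a rel"
  by (induction m) auto

lemma walk_ballI: "(u, v) \<in> E ^^ m \<Longrightarrow> m \<le> k \<Longrightarrow> v \<in> walk_ball E k u"
  by (auto simp: walk_ball_def)

lemma walk_ball_self: "u \<in> walk_ball E k u"
  by (auto simp: walk_ball_def intro: exI[of _ 0])

lemma walk_ball_subset: "A \<subseteq> B \<Longrightarrow> walk_ball A k u \<subseteq> walk_ball B k u"
  unfolding walk_ball_def using relpow_subset[of A B] by fast

lemma relpow_sym: "sym E \<Longrightarrow> (u, v) \<in> E ^^ m \<Longrightarrow> (v, u) \<in> E ^^ m"
proof (induction m arbitrary: v)
  case (Suc m)
  then obtain w where "(u, w) \<in> E ^^ m" "(w, v) \<in> E" by auto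
  with Suc show ?case by (meson relpow_Suc_I2 symD)
qed auto

lemma walk_ball_commute: "sym E \<Longrightarrow> v \<in> walk_ball E k u \<longleftrightarrow> u \<in> walk_ball E k v"
  unfolding walk_ball_def using relpow_sym[of E] by fast

lemma cycles_longer_subset:
  assumes "cycles_longer k B" "A \<subseteq> B"
  shows "cycles_longer k A"
proof -
  have "walk_ball (A - D) k a \<subseteq> walk_ball (B - D) k a" for D a
    by (rule walk_ball_subset) (use assms in blast)
  with assms show ?thesis unfolding cycles_longer_def by blast
qed

lemma cycles_longer_no_loop: "cycles_longer k E \<Longrightarrow> (a, a) \<notin> E"
  using walk_ball_self unfolding cycles_longer_def by fast

text \<open>
  A walk that uses the new edge is cut at the first and at the last visit of an end of this edge; the two
  outer pieces do not use it. The middle piece, which contains at least one step, is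
  discarded, hence the strict inequality.
\<close>

lemma walk_through_new_edge:
  assumes "(x, y) \<in> (F \<union> {(u, v), (v, u)}) ^^ m"
  shows "(x, y) \<in> F ^^ m \<or> (\<exists>p\<in>{u, v}. \<exists>q\<in>{u, v}. \<exists>i j. i + j < m \<and> (x, p) \<in> F ^^ i \<and> (q, y) \<in> F ^^ j)"
  using assms
proof (induction m arbitrary: y)
  case (Suc m)
  then obtain z where z: "(x, z) \<in> (F \<union> {(u, v), (v, u)}) ^^ m" "(z, y) \<in> F \<union> {(u, v), (v, u)}"
    by auto
  from Suc.IH[OF z(1)] show ?case
  proof
    assume xz: "(x, z) \<in> F ^^ m"
    show ?thesis
    proof (cases "(z, y) \<in> F")
      case False
      with z(2) have "z \<in> {u, v}" "y \<in> {u, v}" by auto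
      moreover have "m + 0 < Suc m" "(y, y) \<in> F ^^ 0" by auto
      ultimately show ?thesis using xz by blast
    qed (use xz in auto)
  next
    assume "\<exists>p\<in>{u, v}. \<exists>q\<in>{u, v}. \<exists>i j. i + j < m \<and> (x, p) \<in> F ^^ i \<and> (q, z) \<in> F ^^ j"
    then obtain p q i j where pq: "p \<in> {u, v}" "q \<in> {u, v}" "i + j < m" "(x, p) \<in> F ^^ i" "(q, z) \<in> F ^^ j"
      by blast
    show ?thesis
    proof (cases "(z, y) \<in> F")
      case True
      with pq have "(q, y) \<in> F ^^ Suc j" "i + Suc j < Suc m" by auto
      with pq show ?thesis by blast
    next
      case False
      with z(2) have "y \<in> {u, v}" by auto
      moreover have "i + 0 < Suc m" "(y, y) \<in> F ^^ 0" using pq by auto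
      ultimately show ?thesis using pq by blast
    qed
  qed
qed auto

text \<open>
  A short cycle through the new edge would give a short walk between its ends in the old graph.
\<close>

lemma cycles_longer_add_edge:
  assumes E: "cycles_longer k E" "sym E" and far: "v \<notin> walk_ball E k u"
  shows "cycles_longer k (E \<union> {(u, v), (v, u)})"
  unfolding cycles_longer_def
proof (intro allI impI notI)
  fix a b
  let ?E' = "E \<union> {(u, v), (v, u)}"
  assume ab: "(a, b) \<in> ?E'" and "b \<in> walk_ball (?E' - {(a, b), (b, a)}) k a"
  then obtain m where m: "m \<le> k" "(a, b) \<in> (?E' - {(a, b), (b, a)}) ^^ m"
    by (auto simp: walk_ball_def)
  have far': "u \<notin> walk_ball E k v"
    using far E walk_ball_commute by fast
  show False
  proof (cases "{a, b} = {u, v}")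
    case True
    then have "?E' - {(a, b), (b, a)} \<subseteq> E" by (auto simp: doubleton_eq_iff)
    from walk_ball_subset[OF this] walk_ballI[OF m(2,1)] have "b \<in> walk_ball E k a" ..
    with far far' True show False by (auto simp: doubleton_eq_iff)
  next
    case False
    let ?F = "E - {(a, b), (b, a)}"
    from False ab have abE: "(a, b) \<in> E" "(b, a) \<in> E" using \<open>sym E\<close> by (auto dest: symD)
    have "?E' - {(a, b), (b, a)} = ?F \<union> {(u, v), (v, u)}" using False by auto
    with m have "(a, b) \<in> (?F \<union> {(u, v), (v, u)}) ^^ m" by simp
    from walk_through_new_edge[OF this] show False
    proof
      assume "(a, b) \<in> ?F ^^ m"
      with m E abE show False unfolding cycles_longer_def walk_ball_def by blast
    next
      assume "\<exists>p\<in>{u, v}. \<exists>q\<in>{u, v}. \<exists>i j. i + j < m \<and> (a, p) \<in> ?F ^^ i \<and> (q, b) \<in> ?F ^^ j"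
      then obtain p q i j where pq: "p \<in> {u, v}" "q \<in> {u, v}" "i + j < m" "(a, p) \<in> ?F ^^ i" "(q, b) \<in> ?F ^^ j"
        by blast
      show False
      \<comment> \<open>If the walk enters and leaves the new edge at the same end, the outer pieces already form a
        short walk from \<open>a\<close> to \<open>b\<close>. Otherwise they are joined by the edge \<open>ba\<close> to a walk between \<open>u\<close> and \<open>v\<close>;
        its length is at most \<open>m\<close> since the edge \<open>ba\<close> makes up for the discarded middle piece.\<close>
      proof (cases "p = q")
        case True
        with pq have "(a, b) \<in> ?F ^^ (i + j)" by (meson relpow_trans)
        with pq m E abE show False
          using walk_ballI[of a b "i + j" ?F k] unfolding cycles_longer_def by auto
      next
        case False
        have "?F \<subseteq> E" by auto
        then have ap: "(a, p) \<in> E ^^ i" and qb: "(q, b) \<in> E ^^ j" using pq(4,5) relpow_subset by blast+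
        from qb abE have "(q, a) \<in> E ^^ Suc j" by auto
        with ap have "(q, p) \<in> E ^^ (Suc j + i)" by (meson relpow_trans)
        moreover have "Suc j + i \<le> k" using pq m by simp
        ultimately have "p \<in> walk_ball E k q" by (rule walk_ballI)
        with False pq far far' show False by auto
      qed
    qed
  qed
qed

text \<open>
  The new edges are added one after the other. A short walk from \<open>v\<close> to \<open>y\<close> that uses the edge \<open>ux\<close>
  would end with a short walk to \<open>y\<close> from \<open>u\<close>, which is excluded by distance, or from \<open>x\<close>, which
  would close a short cycle together with the removed edge \<open>xy\<close>. The case \<open>u = v\<close> is included.
\<close>

lemma cycles_longer_switch:
  assumes E: "cycles_longer k E" "sym E" and xy: "(x, y) \<in> E"
    and far: "x \<notin> walk_ball E k u" "y \<notin> walk_ball E k u" "y \<notin> walk_ball E k v"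
  shows "cycles_longer k (E - {(x, y), (y, x)} \<union> {(u, x), (x, u)} \<union> {(v, y), (y, v)})"
proof -
  let ?E1 = "E - {(x, y), (y, x)}"
  have E1: "cycles_longer k ?E1" "sym ?E1"
    using E cycles_longer_subset by (blast, auto simp: sym_def)
  have sub: "walk_ball ?E1 k a \<subseteq> walk_ball E k a" for a by (rule walk_ball_subset) auto
  have "cycles_longer k (?E1 \<union> {(u, x), (x, u)})"
    using cycles_longer_add_edge[OF E1] sub far by blast
  moreover have "sym (?E1 \<union> {(u, x), (x, u)})" using E1 by (auto simp: sym_def)
  moreover have "y \<notin> walk_ball (?E1 \<union> {(u, x), (x, u)}) k v"
  proof
    assume "y \<in> walk_ball (?E1 \<union> {(u, x), (x, u)}) k v"
    then obtain m where m: "m \<le> k" "(v, y) \<in> (?E1 \<union> {(u, x), (x, u)}) ^^ m"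
      by (auto simp: walk_ball_def)
    from walk_through_new_edge[OF m(2)] show False
    proof
      assume "(v, y) \<in> ?E1 ^^ m"
      then have "y \<in> walk_ball ?E1 k v" using m(1) by (rule walk_ballI)
      with far sub show False by blast
    next
      assume "\<exists>p\<in>{u, x}. \<exists>q\<in>{u, x}. \<exists>i j. i + j < m \<and> (v, p) \<in> ?E1 ^^ i \<and> (q, y) \<in> ?E1 ^^ j"
      then obtain q j where q: "q \<in> {u, x}" "j \<le> k" "(q, y) \<in> ?E1 ^^ j"
        using m(1) by (metis add_leD2 le_trans less_imp_le)
      from walk_ballI[OF q(3,2)] have "y \<in> walk_ball ?E1 k q" .
      moreover have "y \<notin> walk_ball ?E1 k x" using E xy by (auto simp: cycles_longer_def)
      ultimately show False using q far sub by blast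
    qed
  qed
  ultimately show ?thesis by (rule cycles_longer_add_edge)
qed

section \<open>The size of balls\<close>

lemma walk_ball_0: "walk_ball E 0 u = {u}"
  by (auto simp: walk_ball_def)

lemma walk_ball_Suc: "walk_ball E (Suc k) u = walk_ball E k u \<union> E `` walk_ball E k u"
proof (intro equalityI subsetI)
  fix v assume "v \<in> walk_ball E (Suc k) u"
  then obtain m where m: "m \<le> Suc k" "(u, v) \<in> E ^^ m" by (auto simp: walk_ball_def)
  show "v \<in> walk_ball E k u \<union> E `` walk_ball E k u"
  proof (cases m)
    case 0 with m show ?thesis by (auto simp: walk_ball_self)
  next
    case (Suc j)
    with m obtain w where "(u, w) \<in> E ^^ j" "(w, v) \<in> E" "j \<le> k" by auto
    then show ?thesis by (auto simp: walk_ball_def)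
  qed
next
  fix v assume "v \<in> walk_ball E k u \<union> E `` walk_ball E k u"
  then show "v \<in> walk_ball E (Suc k) u"
  proof
    assume "v \<in> E `` walk_ball E k u"
    then obtain w m where "m \<le> k" "(u, w) \<in> E ^^ m" "(w, v) \<in> E" by (auto simp: walk_ball_def)
    then show ?thesis by (intro walk_ballI[of u v "Suc m"]) auto
  qed (auto simp: walk_ball_def intro: le_SucI)
qed

text \<open>
  This is the Moore bound. Each vertex at distance \<open>m > 0\<close> from \<open>u\<close> has a neighbour at distance \<open>m - 1\<close>, so it
  has at most \<open>s - 1\<close> neighbours at distance \<open>m + 1\<close>. The centre has no such neighbour, but its own degree
  is assumed to be less than \<open>s\<close>.
\<close>

lemma card_walk_ball_le:
  assumes fin: "finite E" and E: "sym E" and deg: "\<And>v. card (E `` {v}) \<le> s" and u: "card (E `` {u}) < s"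
  shows "card (walk_ball E k u) \<le> 1 + (\<Sum>t = 1..k. (s - 1) ^ t)"
proof -
  let ?B = "\<lambda>m. walk_ball E m u"
  have finE: "finite (E `` X)" for X
    by (rule finite_subset[of _ "snd ` E"]) (use fin in force)+
  have finB: "finite (?B m)" for m
    by (induction m) (simp_all add: walk_ball_0 walk_ball_Suc finE)
  have layer: "card (?B (Suc m) - ?B m) \<le> (s - 1) ^ Suc m" for m
  proof (induction m)
    case 0
    have "?B (Suc 0) - ?B 0 \<subseteq> E `` {u}" by (auto simp: walk_ball_Suc walk_ball_0)
    then have "card (?B (Suc 0) - ?B 0) \<le> card (E `` {u})" by (intro card_mono finE)
    with u show ?case by simp
  next
    case (Suc m)
    let ?L = "?B (Suc m) - ?B m"
    have new: "card (E `` {w} - ?B (Suc m)) \<le> s - 1" if w: "w \<in> ?L" for w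
    proof -
      from w obtain z where z: "z \<in> ?B m" "(z, w) \<in> E" by (auto simp: walk_ball_Suc)
      then have "z \<in> E `` {w}" "z \<in> ?B (Suc m)" using E by (auto simp: walk_ball_Suc dest: symD)
      then have "E `` {w} - ?B (Suc m) \<subset> E `` {w}" by auto
      then have "card (E `` {w} - ?B (Suc m)) < card (E `` {w})" by (intro psubset_card_mono finE)
      with deg[of w] show ?thesis by simp
    qed
    have "?B (Suc (Suc m)) - ?B (Suc m) \<subseteq> (\<Union>w\<in>?L. E `` {w} - ?B (Suc m))"
      using walk_ball_Suc[of E "Suc m" u] walk_ball_Suc[of E m u] by auto
    then have "card (?B (Suc (Suc m)) - ?B (Suc m)) \<le> card (\<Union>w\<in>?L. E `` {w} - ?B (Suc m))"
      by (intro card_mono finite_UN_I) (auto simp: finB finE)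
    also have "\<dots> \<le> (\<Sum>w\<in>?L. card (E `` {w} - ?B (Suc m)))"
      by (intro card_UN_le) (simp add: finB)
    also have "\<dots> \<le> card ?L * (s - 1)"
      using sum_bounded_above[of ?L "\<lambda>w. card (E `` {w} - ?B (Suc m))" "s - 1"] new by simp
    also have "\<dots> \<le> (s - 1) ^ Suc m * (s - 1)" using Suc by (rule mult_right_mono) simp
    finally show ?case by (simp add: mult.commute)
  qed
  show ?thesis
  proof (induction k)
    case 0 show ?case by (simp add: walk_ball_0)
  next
    case (Suc k)
    have "card (?B (Suc k)) \<le> card (?B k) + card (?B (Suc k) - ?B k)"
      using card_Un_le[of "?B k" "?B (Suc k) - ?B k"] by (simp add: walk_ball_Suc Un_commute)
    with Suc layer[of k] show ?case by simp
  qed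
qed


section \<open>Attaining prescribed degrees\<close>

lemma even_sum_degrees:
  assumes V: "finite V" "E \<subseteq> V \<times> V" and E: "sym E" "\<And>a. (a, a) \<notin> E"
  shows "even (\<Sum>v\<in>V. card (E `` {v}))"
proof -
  \<comment> \<open>An injection into the natural numbers serves to orient every edge.\<close>
  obtain f :: "'a \<Rightarrow> nat" where f: "inj_on f V"
    using finite_imp_inj_to_nat_seg[OF V(1)] by auto
  let ?A = "{(a, b) \<in> E. f a < f b}"
  have finE: "finite E" using V by (meson finite_SigmaI finite_subset)
  have "f a \<noteq> f b" if "(a, b) \<in> E" for a b
    using that f V(2) E(2) by (metis inj_onD mem_Sigma_iff subsetD)
  then have "E = ?A \<union> ?A\<inverse>" using \<open>sym E\<close> by (auto dest: symD simp: neq_iff)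
  moreover have "?A \<inter> ?A\<inverse> = {}" by auto
  moreover have "finite ?A" by (rule finite_subset[OF _ finE]) auto
  ultimately have "card E = card ?A + card (?A\<inverse>)"
    by (metis (no_types, lifting) card_Un_disjoint finite_converse)
  then have "even (card E)" by (simp add: card_inverse)
  moreover have "E = Sigma V (\<lambda>v. E `` {v})" using V by auto
  then have "card E = (\<Sum>v\<in>V. card (E `` {v}))"
    using card_SigmaI[OF V(1), of "\<lambda>v. E `` {v}"] finE
    by (metis (no_types, lifting) finite_Image)
  ultimately show ?thesis by simp
qed

text \<open>
  The switching argument for an arbitrary target degree function \<open>d\<close>. The hypothesis \<open>large\<close> counts only
  vertices whose target is the maximal degree \<open>s\<close>: a set of vertices of degree \<open>s\<close> sends its edges into no smaller
  set, whereas vertices of smaller degree could all be attached to the excluded set. The core \<open>C\<close>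
  survives because the switched edge is chosen away from its vertices.
\<close>

lemma saturated_extension_exists:
  fixes d :: "'a \<Rightarrow> nat"
  assumes V: "finite V" and C: "C \<subseteq> V \<times> V" "sym C" "cycles_longer k C"
    and C_deg: "\<And>v. v \<in> V \<Longrightarrow> card (C `` {v}) \<le> d v"
    and d: "\<And>v. v \<in> V \<Longrightarrow> d v \<le> s" "even (\<Sum>v\<in>V. d v)"
    and k: "0 < k"
    and large: "2 * (2 * (1 + (\<Sum>t = 1..k. (s - 1) ^ t)) + card (Field C)) < card {v \<in> V. d v = s}"
  obtains E where "C \<subseteq> E" "E \<subseteq> V \<times> V" "sym E" "cycles_longer k E"
    "\<And>v. v \<in> V \<Longrightarrow> card (E `` {v}) = d v"
proof -
  define P where "P E \<longleftrightarrow> C \<subseteq> E \<and> E \<subseteq> V \<times> V \<and> sym E \<and> cycles_longer k E \<and>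
      (\<forall>v\<in>V. card (E `` {v}) \<le> d v)" for E
  have "P C" using C C_deg by (simp add: P_def)
  moreover have "\<forall>E. P E \<longrightarrow> card E < Suc (card (V \<times> V))"
    using V unfolding P_def less_Suc_eq_le by (meson card_mono finite_SigmaI)
  ultimately have "\<exists>E. P E \<and> (\<forall>E'. P E' \<longrightarrow> card E' \<le> card E)"
    by (rule ex_has_greatest_nat)
  then obtain E where E: "P E" and E_max: "\<And>E'. P E' \<Longrightarrow> card E' \<le> card E"
    by auto
  have finE: "finite E" using E V unfolding P_def by (meson finite_SigmaI finite_subset)
  have sym: "sym E" and VE: "E \<subseteq> V \<times> V" and girth: "cycles_longer k E" and CE: "C \<subseteq> E"
    and deg: "\<And>v. v \<in> V \<Longrightarrow> card (E `` {v}) \<le> d v"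
    using E by (auto simp: P_def)
  have no_loop: "(a, a) \<notin> E" for a using girth by (rule cycles_longer_no_loop)
  have finN: "finite (E `` X)" for X using finE by (rule finite_Image)
  have deg_s: "card (E `` {v}) \<le> s" for v
  proof (cases "v \<in> V")
    case False
    then have "E `` {v} = {}" using VE by auto
    then show ?thesis by simp
  qed (use deg d in fastforce)
  have nbr_ball: "E `` {a} \<subseteq> walk_ball E k a" for a
    using walk_ballI[of a _ 1 E k] k by auto
  \<comment> \<open>Another deficient vertex outside the ball around \<open>u\<close> could be joined to \<open>u\<close>.\<close>
  have far_saturated: "card (E `` {w}) = d w"
    if u: "u \<in> V" "card (E `` {u}) < d u" and w: "w \<in> V" "w \<notin> walk_ball E k u" for u w
  proof (rule ccontr)
    assume "card (E `` {w}) \<noteq> d w"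
    with deg w have w': "card (E `` {w}) < d w" by fastforce
    let ?E' = "E \<union> {(u, w), (w, u)}"
    have "card (?E' `` {z}) \<le> d z" if "z \<in> V" for z
    proof -
      have "u \<noteq> w" using w walk_ball_self by metis
      then have "?E' `` {u} = insert w (E `` {u})" "?E' `` {w} = insert u (E `` {w})"
        "z \<noteq> u \<Longrightarrow> z \<noteq> w \<Longrightarrow> ?E' `` {z} = E `` {z}" by auto
      then show ?thesis
        using u w' deg[OF that] finN by (cases "z = u"; cases "z = w") (simp_all add: card_insert_if)
    qed
    moreover have "sym ?E'" using sym by (auto simp: sym_def)
    moreover have "cycles_longer k ?E'" using girth sym w(2) by (rule cycles_longer_add_edge)
    ultimately have "P ?E'" using CE VE u w by (auto simp: P_def)
    then have "card ?E' \<le> card E" by (rule E_max)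
    moreover have "(u, w) \<notin> E" using nbr_ball w by auto
    then have "E \<subset> ?E'" by auto
    then have "card E < card ?E'" using finE by (intro psubset_card_mono) auto
    ultimately show False by simp
  qed
  have "card (E `` {u}) = d u" if u: "u \<in> V" for u
  proof (rule ccontr)
    assume "card (E `` {u}) \<noteq> d u"
    with deg u have u': "card (E `` {u}) < d u" by fastforce
    \<comment> \<open>The two places at which edges are missing; by parity, a single missing edge cannot occur.\<close>
    obtain v where v: "v \<in> V" "card (E `` {v}) < d v" and uv: "u = v \<Longrightarrow> card (E `` {u}) + 2 \<le> d u"
    proof (cases "\<exists>v\<in>V. v \<noteq> u \<and> card (E `` {v}) < d v")
      case False
      then have eq: "card (E `` {v}) = d v" if "v \<in> V - {u}" for v using deg that by fastforce
      have "(\<Sum>v\<in>V. d v) = d u + (\<Sum>v\<in>V - {u}. d v)" using V u by (rule sum.remove)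
      moreover have "(\<Sum>v\<in>V. card (E `` {v})) = card (E `` {u}) + (\<Sum>v\<in>V - {u}. card (E `` {v}))"
        using V u by (rule sum.remove)
      moreover have "(\<Sum>v\<in>V - {u}. card (E `` {v})) = (\<Sum>v\<in>V - {u}. d v)"
        using eq by (rule sum.cong[OF refl])
      moreover have "even (\<Sum>v\<in>V. card (E `` {v}))"
        using V VE sym no_loop by (rule even_sum_degrees)
      ultimately have "even (d u) \<longleftrightarrow> even (card (E `` {u}))" using d(2) by auto
      then have "card (E `` {u}) + 1 \<noteq> d u" by (metis even_plus_one_iff)
      with u' have "card (E `` {u}) + 2 \<le> d u" by simp
      with that[of u] u u' show thesis by simp
    qed (use that in blast)
    define X where "X = walk_ball E k u \<union> walk_ball E k v \<union> Field C"
    define S where "S = {w \<in> V. d w = s} - X"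
    have finS: "finite S" using V by (simp add: S_def)
    have ball: "card (walk_ball E k w) \<le> 1 + (\<Sum>t = 1..k. (s - 1) ^ t)" if "w \<in> {u, v}" for w
      using that u u' v d(1) by (intro card_walk_ball_le finE sym deg_s) fastforce
    have "walk_ball E k w \<subseteq> insert w V" for w
      by (induction k) (use VE in \<open>auto simp: walk_ball_0 walk_ball_Suc\<close>)
    then have "finite (walk_ball E k w)" for w using V by (meson finite_insert finite_subset)
    moreover have "Field C \<subseteq> V" using C by (auto simp: Field_def)
    then have "finite (Field C)" using V by (rule finite_subset)
    ultimately have finX: "finite X" by (simp add: X_def)
    have "card X \<le> card (walk_ball E k u) + card (walk_ball E k v) + card (Field C)"
      unfolding X_def by (meson add_le_mono1 card_Un_le le_trans)
    with ball[of u] ball[of v]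
    have cardX: "card X \<le> 2 * (1 + (\<Sum>t = 1..k. (s - 1) ^ t)) + card (Field C)" by simp
    have "card {w \<in> V. d w = s} \<le> card S + card X"
      using card_Un_le[of S X] card_mono[of "S \<union> X" "{w \<in> V. d w = s}"] finS finX
      unfolding S_def by fastforce
    with cardX large have SX: "card X < card S" by simp
    \<comment> \<open>Otherwise all edges at \<open>S\<close> would end in \<open>X\<close>, and counting them from both sides would
      give \<open>s * card S \<le> s * card X\<close>.\<close>
    have "\<exists>x\<in>S. \<exists>y. (x, y) \<in> E \<and> y \<notin> X"
    proof (rule ccontr)
      assume "\<not> (\<exists>x\<in>S. \<exists>y. (x, y) \<in> E \<and> y \<notin> X)"
      then have SE: "y \<in> X" if "x \<in> S" "(x, y) \<in> E" for x y using that by auto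
      have "card (E `` {x}) = s" if "x \<in> S" for x
        using far_saturated[OF u u', of x] that by (auto simp: S_def X_def)
      then have "s * card S = (\<Sum>x\<in>S. card (E `` {x}))" by simp
      also have "\<dots> = card (Sigma S (\<lambda>x. E `` {x}))"
        using finS finN by simp
      also have "\<dots> \<le> card (Sigma X (\<lambda>y. E `` {y}))"
      proof (rule card_inj_on_le)
        show "inj_on prod.swap (Sigma S (\<lambda>x. E `` {x}))" by (simp add: inj_on_def)
        show "prod.swap ` Sigma S (\<lambda>x. E `` {x}) \<subseteq> Sigma X (\<lambda>y. E `` {y})"
          using SE sym by (auto dest: symD)
      qed (use finX finN in auto)
      also have "\<dots> = (\<Sum>y\<in>X. card (E `` {y}))" using finX finN by simp
      also have "\<dots> \<le> s * card X"
        using sum_bounded_above[of X "\<lambda>y. card (E `` {y})" s] deg_s by (simp add: mult.commute)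
      finally have "s * card S \<le> s * card X" .
      moreover have "0 < s" using u' d(1)[OF u] by simp
      ultimately show False using SX by simp
    qed
    then obtain x y where x: "x \<in> S" and xy: "(x, y) \<in> E" and y: "y \<notin> X" by blast
    have xX: "x \<notin> X" using x by (simp add: S_def)
    have xyV: "x \<in> V" "y \<in> V" using xy VE by auto
    have yx: "(y, x) \<in> E" using xy sym by (auto dest: symD)
    have neq: "x \<noteq> y" "x \<noteq> u" "y \<noteq> u" "x \<noteq> v" "y \<noteq> v"
      using xy no_loop xX y walk_ball_self[of u E k] walk_ball_self[of v E k] by (auto simp: X_def)
    have nonadj: "(u, x) \<notin> E" "(v, y) \<notin> E" "(x, u) \<notin> E" "(y, v) \<notin> E"
      using nbr_ball xX y sym by (auto simp: X_def dest: symD)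
    define E' where "E' = E - {(x, y), (y, x)} \<union> {(u, x), (x, u)} \<union> {(v, y), (y, v)}"
    have "card (E' `` {z}) \<le> d z" if z: "z \<in> V" for z
    proof -
      have swap: "card (insert b (N - {a})) \<le> card N" if "finite N" "a \<in> N" for a b :: 'a and N
        using that by (metis card_Diff_singleton card_insert_le_m1 card_gt_0_iff empty_iff order_refl)
      consider "z = x" | "z = y" | "z = u" "u = v" | "z = u" "u \<noteq> v" | "z = v" "u \<noteq> v"
        | "z \<notin> {x, y, u, v}" by blast
      then show ?thesis
      proof cases
        case 1
        then have "E' `` {z} = insert u (E `` {x} - {y})" using neq by (auto simp: E'_def)
        with swap[OF finN, of y "{x}" u] xy deg[OF xyV(1)] 1 show ?thesis by simp
      next
        case 2
        then have "E' `` {z} = insert v (E `` {y} - {x})" using neq by (auto simp: E'_def)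
        with swap[OF finN, of x "{y}" v] yx deg[OF xyV(2)] 2 show ?thesis by simp
      next
        case 3
        then have "E' `` {z} = insert x (insert y (E `` {u}))" using neq by (auto simp: E'_def)
        with 3 uv finN show ?thesis by (simp add: card_insert_if)
      next
        case 4
        then have "E' `` {z} = insert x (E `` {u})" using neq by (auto simp: E'_def)
        with 4 u' finN show ?thesis by (simp add: card_insert_if)
      next
        case 5
        then have "E' `` {z} = insert y (E `` {v})" using neq by (auto simp: E'_def)
        with 5 v finN show ?thesis by (simp add: card_insert_if)
      next
        case 6
        then have "E' `` {z} = E `` {z}" by (auto simp: E'_def)
        with deg[OF z] show ?thesis by simp
      qed
    qed
    moreover have "sym E'" using sym by (auto simp: E'_def sym_def)
    moreover have "cycles_longer k E'"
      unfolding E'_def using girth sym xy xX y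
      by (intro cycles_longer_switch) (auto simp: X_def)
    moreover have "C \<subseteq> E'"
      using CE xX y by (auto simp: E'_def X_def Field_def)
    moreover have "E' \<subseteq> V \<times> V" using VE xyV u v by (auto simp: E'_def)
    ultimately have "P E'" by (simp add: P_def)
    then have "card E' \<le> card E" by (rule E_max)
    moreover have "card E' = card (E - {(x, y), (y, x)}) + card {(u, x), (x, u), (v, y), (y, v)}"
    proof -
      have "E' = (E - {(x, y), (y, x)}) \<union> {(u, x), (x, u), (v, y), (y, v)}" by (auto simp: E'_def)
      then show ?thesis using finE nonadj by (simp only:) (subst card_Un_disjoint; auto)
    qed
    moreover have "card (E - {(x, y), (y, x)}) = card E - 2"
      using xy yx neq by (subst card_Diff_subset) auto
    moreover have "card {(u, x), (x, u), (v, y), (y, v)} = 4" using neq by auto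
    moreover have "0 < card E" using finE xy card_gt_0_iff by blast
    ultimately show False by linarith
  qed
  with that CE VE sym girth show thesis by blast
qed

section \<open>The initial cycle\<close>

definition path_edges :: "nat \<Rightarrow> nat rel" where
  "path_edges g = {(i, j). i < g \<and> j < g \<and> (j = Suc i \<or> i = Suc j)}"

definition cycle_edges :: "nat \<Rightarrow> nat rel" where
  "cycle_edges g = path_edges g \<union> {(0, g - 1), (g - 1, 0)}"

lemma relpow_invariant:
  "(x, y) \<in> R ^^ m \<Longrightarrow> I x \<Longrightarrow> (\<And>z w. (z, w) \<in> R \<Longrightarrow> I z \<Longrightarrow> I w) \<Longrightarrow> I y"
  by (induction m arbitrary: y) auto

lemma sym_path_edges: "sym (path_edges g)"
  by (auto simp: path_edges_def sym_def)

text \<open>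
  Without the edge between \<open>a\<close> and \<open>Suc a\<close> the path falls apart into the vertices up to \<open>a\<close> and those above.
\<close>

lemma cycles_longer_path_edges: "cycles_longer k (path_edges g)"
  unfolding cycles_longer_def
proof (intro allI impI notI)
  fix a b
  let ?R = "path_edges g - {(a, b), (b, a)}"
  assume ab: "(a, b) \<in> path_edges g" and "b \<in> walk_ball ?R k a"
  then obtain m where m: "(a, b) \<in> ?R ^^ m" by (auto simp: walk_ball_def)
  show False
  proof (cases "b = Suc a")
    case True
    from m have "b \<le> a"
      by (rule relpow_invariant) (use True in \<open>auto simp: path_edges_def\<close>)
    with True show False by simp
  next
    case False
    with ab have a: "a = Suc b" by (auto simp: path_edges_def)
    from m have "a \<le> b"
      by (rule relpow_invariant) (use a in \<open>auto simp: path_edges_def\<close>)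
    with a show False by simp
  qed
qed

text \<open>
  The closing edge joins \<open>0\<close> to \<open>g - 1\<close>, and each step along the path changes the vertex by one only.
\<close>

lemma cycles_longer_cycle_edges:
  assumes "3 \<le> g"
  shows "cycles_longer (g - 2) (cycle_edges g)"
  unfolding cycle_edges_def
proof (rule cycles_longer_add_edge)
  have "j \<le> m" if "(0, j) \<in> path_edges g ^^ m" for j m
    using that by (induction m arbitrary: j) (force simp: path_edges_def)+
  then show "g - 1 \<notin> walk_ball (path_edges g) (g - 2) 0"
    using assms by (fastforce simp: walk_ball_def)
qed (simp_all add: cycles_longer_path_edges sym_path_edges)

lemma sym_cycle_edges: "sym (cycle_edges g)"
  using sym_path_edges by (auto simp: cycle_edges_def sym_def)

lemma cycle_edges_bounded: "0 < g \<Longrightarrow> cycle_edges g \<subseteq> {..<g} \<times> {..<g}"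
  by (auto simp: cycle_edges_def path_edges_def)

lemma card_cycle_edges_Image: "card (cycle_edges g `` {v}) \<le> 2"
proof -
  have "cycle_edges g `` {v} \<subseteq> {if v = 0 then g - 1 else v - 1, if v = g - 1 then 0 else Suc v}"
    by (auto simp: cycle_edges_def path_edges_def)
  from card_mono[OF _ this] show ?thesis by (rule order_trans) (simp_all add: card_insert_if)
qed

section \<open>From relations to graphs\<close>

lemma relpow_pcas: "pcas a p b \<Longrightarrow> set p \<subseteq> R \<Longrightarrow> (a, b) \<in> R ^^ length p"
proof (induction p arbitrary: a)
  case (Cons e p)
  then have "(a, snd e) \<in> R" "(snd e, b) \<in> R ^^ length p" by (cases e; auto)+
  then show ?case using relpow_Suc_I2 by fastforce
qed auto

lemma set_pawalk_verts: "pcas a p b \<Longrightarrow> set (pawalk_verts a p) = insert a (snd ` set p)"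
  by (induction p arbitrary: a) auto

lemma set_pawalk_verts': "pcas a p b \<Longrightarrow> set (pawalk_verts a p) = insert b (fst ` set p)"
  by (induction p arbitrary: a) auto

text \<open>
  Removing the first arc \<open>(a, b)\<close> from a cycle leaves a walk from \<open>b\<close> to \<open>a\<close>. It avoids this edge in both
  directions: its vertices are distinct, and its length is at least two because cycles of length two do not count.
\<close>

lemma girth_eqI:
  assumes E: "cycles_longer (g - 2) E" "sym E"
    and p: "ugraph_cycle \<lparr>pverts = V, parcs = E\<rparr> p" "length p = g"
  shows "girth \<lparr>pverts = V, parcs = E\<rparr> = enat g"
proof -
  let ?G = "\<lparr>pverts = V, parcs = E\<rparr>"
  have "g \<le> length p" if "ugraph_cycle ?G p" for p
  proof -
    from that obtain u where cyc: "set p \<subseteq> E" "pcas u p u" "distinct (tl (pawalk_verts u p))" "3 \<le> length p"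
      by (auto simp: ugraph_cycle_def pre_digraph.cycle_def pre_digraph.awalk_def
          cas_with_proj_eq awalk_verts_with_proj_eq)
    then obtain a b c q where pq: "p = (a, b) # (b, c) # q" and q: "q \<noteq> []"
      by (cases p; cases "tl p"; cases "tl (tl p)") auto
    with cyc have ab: "(a, b) \<in> E" "pcas c q a" "b \<notin> set (pawalk_verts c q)" "distinct (pawalk_verts c q)"
      and bq: "pcas b ((b, c) # q) a" "set ((b, c) # q) \<subseteq> E" by auto
    have b: "b \<notin> fst ` set q" "b \<notin> snd ` set q" "b \<noteq> c"
      using ab set_pawalk_verts[OF ab(2)] set_pawalk_verts'[OF ab(2)] by auto
    have "c \<noteq> a"
    proof
      assume "c = a"
      obtain e q' where "q = e # q'" using q by (cases q) auto
      with ab \<open>c = a\<close> have "c \<notin> set (pawalk_verts (snd e) q')" "pcas (snd e) q' c" by auto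
      then show False using set_pawalk_verts' by fast
    qed
    with b have "(a, b) \<notin> set ((b, c) # q)" "(b, a) \<notin> set ((b, c) # q)" by force+
    with bq have "(b, a) \<in> (E - {(b, a), (a, b)}) ^^ length ((b, c) # q)"
      by (intro relpow_pcas) auto
    moreover have "(b, a) \<in> E" using ab E by (auto dest: symD)
    then have "a \<notin> walk_ball (E - {(b, a), (a, b)}) (g - 2) b"
      using E by (simp add: cycles_longer_def)
    ultimately have "\<not> length ((b, c) # q) \<le> g - 2" by (auto simp del: list.size dest: walk_ballI)
    with pq show ?thesis by simp
  qed
  then show ?thesis unfolding girth_def using p by (intro antisym INF_greatest INF_lower2) auto
qed

lemma cycle_edges_ugraph_cycle:
  assumes g: "3 \<le> g" and E: "cycle_edges g \<subseteq> E" "E \<subseteq> V \<times> V"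
  shows "\<exists>p. ugraph_cycle \<lparr>pverts = V, parcs = E\<rparr> p \<and> length p = g"
proof -
  let ?q = "map (\<lambda>i. (i, Suc i)) [0..<g - 1]"
  let ?p = "?q @ [(g - 1, 0)]"
  have q: "pcas k (map (\<lambda>i. (i, Suc i)) [k..<m] @ [(m, 0)]) 0 \<and>
       pawalk_verts k (map (\<lambda>i. (i, Suc i)) [k..<m] @ [(m, 0)]) = [k..<Suc m] @ [0]"
    if "k \<le> m" for k m :: nat
    using that by (induction rule: inc_induct) (simp_all add: upt_conv_Cons del: upt_Suc)
  have "set ?p \<subseteq> E" using E(1) g by (auto simp: cycle_edges_def path_edges_def)
  moreover have "(g - 1, 0) \<in> E" using E by (auto simp: cycle_edges_def)
  then have "0 \<in> V" using E by auto
  moreover have "distinct (tl ([0..<Suc (g - 1)] @ [0]))" by (simp add: upt_rec[of 0])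
  ultimately have "ugraph_cycle \<lparr>pverts = V, parcs = E\<rparr> ?p"
    using q[of 0 "g - 1"] g
    unfolding ugraph_cycle_def pre_digraph.cycle_def pre_digraph.awalk_def
      cas_with_proj_eq awalk_verts_with_proj_eq by (intro conjI exI[of _ 0]) auto
  moreover have "length ?p = g" using g by simp
  ultimately show ?thesis by blast
qed

lemma pair_graph_of_rel:
  assumes "finite V" "E \<subseteq> V \<times> V" "sym E" "\<And>a. (a, a) \<notin> E"
  shows "pair_graph \<lparr>pverts = V, parcs = E\<rparr>"
proof -
  have "finite E" using assms by (meson finite_SigmaI finite_subset)
  then show ?thesis
    using assms by unfold_locales (auto simp: symmetric_def)
qed

lemma out_degree_of_rel: "out_degree (with_proj \<lparr>pverts = V, parcs = E\<rparr>) v = card (E `` {v})"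
proof -
  have "out_arcs (with_proj \<lparr>pverts = V, parcs = E\<rparr>) v = Pair v ` (E `` {v})"
    by (auto simp: out_arcs_def)
  then show ?thesis by (simp add: out_degree_def card_image inj_on_def)
qed

section \<open>Balanced biregular graphs of given girth\<close>

text \<open>
  Half of the vertices, those below \<open>n\<close>, get the target \<open>r\<close> and the other half the target \<open>s\<close>. With \<open>n = 16 * B\<close> the
  sum \<open>n * (r + s)\<close> of the targets is even, and \<open>g \<le> B + 1\<close> and \<open>2 \<le> B\<close> give
  \<open>2 * (2 * (1 + B) + g) \<le> 6 * (B + 1) < n\<close>, as the switching argument requires.
\<close>

theorem babi_graph_exists:
  fixes r s g :: nat
  assumes rs: "2 \<le> r" "r < s" and g: "3 \<le> g"
  shows "\<exists>G :: nat pair_pre_digraph. babi_graph r s g G \<and>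
    card (pverts G) = 32 * (\<Sum>t = 1..g - 2. (s - 1) ^ t)"
proof -
  define B where "B = (\<Sum>t = 1..g - 2. (s - 1) ^ t)"
  define n where "n = 16 * B"
  define V where "V = {..<2 * n}"
  define d where "d v = (if v < n then r else s)" for v
  have "(\<Sum>t = 1..g - 2. 2) \<le> B"
    unfolding B_def
  proof (rule sum_mono)
    fix t assume "t \<in> {1..g - 2}"
    then have "s - 1 \<le> (s - 1) ^ t" using rs by (intro self_le_power) auto
    with rs show "2 \<le> (s - 1) ^ t" by linarith
  qed
  then have B: "2 * (g - 2) \<le> B" by simp
  with g have gB: "g \<le> B + 1" "2 \<le> B" by simp_all
  have V_split: "V = {..<n} \<union> {n..<2 * n}" by (auto simp: V_def)
  have dr: "{v \<in> V. d v = r} = {..<n}" and ds: "{v \<in> V. d v = s} = {n..<2 * n}"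
    using rs by (auto simp: V_def d_def)
  let ?C = "cycle_edges g"
  have "?C \<subseteq> {..<g} \<times> {..<g}" using g by (intro cycle_edges_bounded) simp
  moreover from this have "Field ?C \<subseteq> {..<g}" by (auto simp: Field_def)
  then have "card (Field ?C) \<le> g" using card_mono[of "{..<g}"] by fastforce
  ultimately have CV: "?C \<subseteq> V \<times> V" and "card (Field ?C) \<le> g"
    using gB by (force simp: V_def n_def)+
  then have large: "2 * (2 * (1 + B) + card (Field ?C)) < card {v \<in> V. d v = s}"
    using gB by (simp add: ds n_def)
  have "(\<Sum>v\<in>V. d v) = n * r + n * s"
    unfolding V_split by (subst sum.union_disjoint) (auto simp: d_def)
  then have even: "even (\<Sum>v\<in>V. d v)" by (simp add: n_def)
  have "card (?C `` {v}) \<le> d v" for v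
    using card_cycle_edges_Image[of g v] rs by (simp add: d_def)
  moreover have "d v \<le> s" for v using rs by (simp add: d_def)
  moreover have "finite V" "0 < g - 2" using g by (simp_all add: V_def)
  ultimately obtain E where E: "?C \<subseteq> E" "E \<subseteq> V \<times> V" "sym E" "cycles_longer (g - 2) E"
    and deg: "\<And>v. v \<in> V \<Longrightarrow> card (E `` {v}) = d v"
    using saturated_extension_exists[OF _ CV sym_cycle_edges cycles_longer_cycle_edges[OF g] _ _ even _ large[unfolded B_def]]
    by metis
  let ?G = "\<lparr>pverts = V, parcs = E\<rparr>"
  have degG: "out_degree (with_proj ?G) v = d v" if "v \<in> V" for v
    using deg that by (simp add: out_degree_of_rel)
  have "pair_graph ?G"
    using E cycles_longer_no_loop[OF E(4)] by (intro pair_graph_of_rel) (auto simp: V_def)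
  moreover have "girth ?G = enat g"
    using cycle_edges_ugraph_cycle[OF g E(1,2)] girth_eqI[OF E(4,3)] by blast
  moreover have "d ` V = {r, s}"
    unfolding V_split using gB by (force simp: d_def n_def)
  then have "out_degree (with_proj ?G) ` V = {r, s}" using degG by simp
  moreover have "{v \<in> V. out_degree (with_proj ?G) v = r} = {..<n}"
    "{v \<in> V. out_degree (with_proj ?G) v = s} = {n..<2 * n}"
    unfolding dr[symmetric] ds[symmetric] using degG by auto
  ultimately have "babi_graph r s g ?G" by (simp add: babi_graph_def n_def)
  moreover have "card (pverts ?G) = 32 * B" by (simp add: V_def n_def)
  ultimately show ?thesis unfolding B_def by blast
qed

theorem theorem3p5:
  fixes r s g :: nat
  assumes "2 \<le> r" and "r < s" and "3 \<le> g"
  shows "(\<exists>G :: nat pair_pre_digraph. babi_graph r s g G) \<and>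
    n_bb r s g \<le> 32 * (\<Sum>t = 1..g - 2. (r - 1) ^ t) * (\<Sum>t = 1..g - 2. (s - 1) ^ t)"
proof
  let ?A = "\<Sum>t = 1..g - 2. (r - 1) ^ t" and ?B = "\<Sum>t = 1..g - 2. (s - 1) ^ t"
  from babi_graph_exists[OF assms] obtain G :: "nat pair_pre_digraph"
    where G: "babi_graph r s g G" "card (pverts G) = 32 * ?B" by blast
  from G show "\<exists>G :: nat pair_pre_digraph. babi_graph r s g G" by blast
  have "n_bb r s g \<le> 32 * ?B"
    unfolding n_bb_def using G by (intro Least_le) blast
  also have "(r - 1) ^ 1 \<le> ?A"
    using assms by (intro member_le_sum) auto
  then have "1 \<le> ?A" using assms by simp
  then have "32 * ?B \<le> 32 * ?A * ?B" by simp
  finally show "n_bb r s g \<le> 32 * ?A * ?B" .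
qed

end
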